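(* Let $N, H, L \ge 1$ be integers, and let $f_\theta : \mathbb{R}^N \to \mathbb{R}^N$ be a Fourier Neural Operator on the fixed grid of size $N$, with hidden width $H$, $L$ hidden layers, fixed learned parameters $\theta$ and ReLU nonlinearities (as defined in the context). Then $f_\theta$ is a piecewise-linear map from the discretized input function $u \in \mathbb{R}^N$ to the discretized output function $f_\theta(u) \in \mathbb{R}^N$.
   Context: Fourier Neural Operator (FNO) on a fixed grid. Fix a grid with $N$ points, a hidden width $H$ and a number of layers $L$. A discretized function is a vector $u \in \mathbb{R}^N$. Hidden states are real arrays $h \in \mathbb{R}^{N \times H}$ ($N$ grid points, $H$ channels). With all learned parameters held fixed, the FNO $f_\theta$ is the composition of the following maps. (1) A lifting layer: an affine map $P : \mathbb{R}^N \to \mathbb{R}^{N\times H}$, giving $h^{(0)} = P(u)$. (2) For $\ell = 1,\dots,L$, a hidden layer $$z^{(\ell)}_{ij} = \big(\mathcal{K}_\ell(h^{(\ell-1)})\big)_{ij} + \sum_{m=1}^{H} W^{\mathrm{byp}}_{\ell,jm}\, h^{(\ell-1)}_{im} + b_{\ell,j}, \qquad h^{(\ell)}_{ij} = \sigma_\ell\big(z^{(\ell)}_{ij}\big),$$ where $W^{\mathrm{byp}}_\ell \in \mathbb{R}^{H\times H}$ is the pointwise bypass matrix, $b_\ell \in \mathbb{R}^H$ is a bias, and $\sigma_\ell$ is applied coordinate-wise and is either the ReLU $\sigma_\ell(t) = \max(t,0)$ or, for layers without nonlinearity, the identity $\sigma_\ell(t)=t$. The spectral convolution $\mathcal{K}_\ell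 : \mathbb{R}^{N\times H} \to \mathbb{R}^{N \times H}$ is $$\mathcal{K}_\ell(h) = \operatorname{IFFT}\big(R_\ell \odot \operatorname{FFT}(h)\big),$$ where $\operatorname{FFT}$ and $\operatorname{IFFT}$ are the discrete Fourier transform of length $N$ along the grid dimension (applied separately to each channel) and its inverse, $\odot$ is entrywise multiplication, and $R_\ell \in \mathbb{C}^{N \times H}$ is the fixed array of learned mode weights (with zero entries at the truncated modes). It satisfies the conjugate symmetry $R_{\ell,(-k \bmod N),j} = \overline{R_{\ell,k,j}}$ for all modes $k \in \{0,\dots,N-1\}$ and channels $j$, so that $\mathcal{K}_\ell$ maps real arrays to real arrays. (3) A projection layer: an affine map $Q : \mathbb{R}^{N\times H} \to \mathbb{R}^{N}$, giving $f_\theta(u) = Q(h^{(L)})$. Piecewise-linear map: a map $g : \mathbb{R}^n \to \mathbb{R}^m$ is piecewise-linear if $\mathbb{R}^n$ is the union of finitely many closed convex polyhedra (finite intersections of closed half-spaces) on each of which $g$ coincides with an affine map. *)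

theory Defs
  imports "HOL-Analysis.Analysis"
begin

definition affine_map :: "('a::real_vector \<Rightarrow> 'b::real_vector) \<Rightarrow> bool" where
  "affine_map f \<longleftrightarrow> (\<exists>A c. linear A \<and> (\<forall>x. f x = A x + c))"

definition piecewise_linear :: "('a::euclidean_space \<Rightarrow> 'b::euclidean_space) \<Rightarrow> bool" where
  "piecewise_linear g \<longleftrightarrow>
     (\<exists>\<P>. finite \<P> \<and> (\<forall>S\<in>\<P>. polyhedron S) \<and> \<Union>\<P> = UNIV \<and>
          (\<forall>S\<in>\<P>. \<exists>f. affine_map f \<and> (\<forall>x\<in>S. g x = f x)))"

text \<open>
  The grid points, and likewise the Fourier modes, are the elements of a finite type \<open>'n\<close>;
  an enumeration \<open>idx\<close>, a bijection from \<open>'n\<close> onto \<open>{0..<N}\<close> with \<open>N = CARD('n)\<close>, gives the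
  position of a grid point and the frequency of a mode. Channels are the elements of a finite
  type \<open>'h\<close>, and an \<open>N \<times> H\<close> array has type \<open>_^'h^'n\<close>.
\<close>

definition fft :: "('n::finite \<Rightarrow> nat) \<Rightarrow> complex^'h^'n \<Rightarrow> complex^'h^'n" where
  "fft idx h = (\<chi> k j. \<Sum>i\<in>UNIV.
     h $ i $ j * cis (- (2 * pi * real (idx k) * real (idx i) / real CARD('n))))"

definition ifft :: "('n::finite \<Rightarrow> nat) \<Rightarrow> complex^'h^'n \<Rightarrow> complex^'h^'n" where
  "ifft idx X = (\<chi> i j. (\<Sum>k\<in>UNIV.
     X $ k $ j * cis (2 * pi * real (idx k) * real (idx i) / real CARD('n))) / of_nat CARD('n))"

definition complex_array :: "real^'h^'n \<Rightarrow> complex^'h^'n" where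
  "complex_array h = (\<chi> i j. complex_of_real (h $ i $ j))"

definition conj_symmetric :: "('n::finite \<Rightarrow> nat) \<Rightarrow> complex^'h^'n \<Rightarrow> bool" where
  "conj_symmetric idx R \<longleftrightarrow>
     (\<forall>k k' j. int (idx k') = (- int (idx k)) mod int CARD('n) \<longrightarrow> R $ k' $ j = cnj (R $ k $ j))"

text \<open>
  The product of two arrays is entrywise. Taking real parts only changes the type from complex
  to real: for conjugate symmetric weights nothing is lost, see \<open>complex_array_spectral_conv\<close>.
\<close>

definition spectral_conv ::
  "('n::finite \<Rightarrow> nat) \<Rightarrow> complex^'h^'n \<Rightarrow> real^'h^'n \<Rightarrow> real^'h^'n" where
  "spectral_conv idx R h = (\<chi> i j. Re (ifft idx (R * fft idx (complex_array h)) $ i $ j))"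

definition relu :: "real \<Rightarrow> real" where
  "relu t = max t 0"

definition hidden_layer ::
  "('n::finite \<Rightarrow> nat) \<Rightarrow> complex^'h^'n \<Rightarrow> real^'h^'h \<Rightarrow> real^'h \<Rightarrow> (real \<Rightarrow> real) \<Rightarrow>
     real^'h^'n \<Rightarrow> real^'h^'n" where
  "hidden_layer idx R W b \<sigma> h =
     (\<chi> i j. \<sigma> (spectral_conv idx R h $ i $ j + (\<Sum>m\<in>UNIV. W $ j $ m * h $ i $ m) + b $ j))"

primrec hidden_state ::
  "('n::finite \<Rightarrow> nat) \<Rightarrow> (real^'n \<Rightarrow> real^'h^'n) \<Rightarrow> (nat \<Rightarrow> complex^'h^'n) \<Rightarrow>
     (nat \<Rightarrow> real^'h^'h) \<Rightarrow> (nat \<Rightarrow> real^'h) \<Rightarrow> (nat \<Rightarrow> real \<Rightarrow> real) \<Rightarrow>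
     nat \<Rightarrow> real^'n \<Rightarrow> real^'h^'n" where
  "hidden_state idx P R W b \<sigma> 0 u = P u"
| "hidden_state idx P R W b \<sigma> (Suc l) u =
     hidden_layer idx (R (Suc l)) (W (Suc l)) (b (Suc l)) (\<sigma> (Suc l))
       (hidden_state idx P R W b \<sigma> l u)"

definition fno ::
  "('n::finite \<Rightarrow> nat) \<Rightarrow> (real^'n \<Rightarrow> real^'h^'n) \<Rightarrow> (nat \<Rightarrow> complex^'h^'n) \<Rightarrow>
     (nat \<Rightarrow> real^'h^'h) \<Rightarrow> (nat \<Rightarrow> real^'h) \<Rightarrow> (nat \<Rightarrow> real \<Rightarrow> real) \<Rightarrow>
     (real^'h^'n \<Rightarrow> real^'n) \<Rightarrow> nat \<Rightarrow> real^'n \<Rightarrow> real^'n" where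
  "fno idx P R W b \<sigma> Q L u = Q (hidden_state idx P R W b \<sigma> L u)"

lemma cis_cong_mod:
  fixes a b N :: int
  assumes "a mod N = b mod N" "N > 0"
  shows "cis (2 * pi * real_of_int a / real_of_int N) = cis (2 * pi * real_of_int b / real_of_int N)"
proof -
  obtain q where q: "a = b + N * q"
    using assms(1) by (metis mod_eqE)
  have "2 * pi * real_of_int a / real_of_int N =
        2 * pi * real_of_int b / real_of_int N + 2 * pi * real_of_int q"
    using assms(2) by (simp add: q field_simps)
  moreover have "cis (2 * pi * real_of_int q) = 1"
    by (rule cis_multiple_2pi) simp
  ultimately show ?thesis
    by (simp add: cis_mult[symmetric])
qed

lemma complex_array_spectral_conv:
  fixes idx :: "'n::finite \<Rightarrow> nat" and R :: "complex^'h^'n"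
  assumes idx: "bij_betw idx UNIV {0..<CARD('n)}" and R: "conj_symmetric idx R"
  shows "complex_array (spectral_conv idx R h) = ifft idx (R * fft idx (complex_array h))"
proof -
  define N where "N = int CARD('n)"
  have N: "N > 0" by (simp add: N_def)
  define X where "X = R * fft idx (complex_array h)"
  define \<nu> where "\<nu> k = (THE k'. int (idx k') = (- int (idx k)) mod N)" for k
  have inj: "inj idx" using idx by (rule bij_betw_imp_inj_on)
  have \<nu>: "int (idx (\<nu> k)) = (- int (idx k)) mod N" for k
  proof -
    have "nat ((- int (idx k)) mod N) \<in> {0..<CARD('n)}"
      using N by (auto simp: N_def nat_less_iff)
    then obtain k' where "idx k' = nat ((- int (idx k)) mod N)"
      using idx by (metis bij_betw_imp_surj_on imageE)
    then have "int (idx k') = (- int (idx k)) mod N"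
      using N by simp
    then show ?thesis
      unfolding \<nu>_def by (rule theI) (metis \<open>int (idx k') = _\<close> inj injD of_nat_eq_iff)
  qed
  have lt: "int (idx k) < N" for k
    using bij_betwE[OF idx] by (auto simp: N_def)
  have "int (idx (\<nu> (\<nu> k))) = int (idx k)" for k
    using lt[of k] by (simp add: \<nu> mod_minus_eq)
  then have inv: "\<nu> (\<nu> k) = k" for k
    using inj by (simp add: inj_def)
  have bij: "bij \<nu>"
    by (rule o_bij[of \<nu>]) (auto simp: inv)
  have w: "cis (2 * pi * real (idx (\<nu> k)) * real (idx i) / real CARD('n)) =
           cnj (cis (2 * pi * real (idx k) * real (idx i) / real CARD('n)))" for k i
  proof -
    have "(int (idx (\<nu> k)) * int (idx i)) mod N = (- (int (idx k) * int (idx i))) mod N"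
      unfolding \<nu> by (metis mod_mult_left_eq mult_minus_left)
    from cis_cong_mod[OF this N] show ?thesis
      by (simp add: N_def cis_cnj mult.assoc)
  qed
  have F: "fft idx (complex_array h) $ \<nu> k $ j = cnj (fft idx (complex_array h) $ k $ j)" for k j
    using w by (simp add: fft_def complex_array_def cis_cnj[symmetric])
  have X: "X $ \<nu> k $ j = cnj (X $ k $ j)" for k j
    using R \<nu>[of k] F by (simp add: X_def conj_symmetric_def N_def)
  have "cnj (ifft idx X $ i $ j) = ifft idx X $ i $ j" for i j
  proof -
    let ?g = "\<lambda>k. X $ k $ j * cis (2 * pi * real (idx k) * real (idx i) / real CARD('n))"
    have "cnj (\<Sum>k\<in>UNIV. ?g k) = (\<Sum>k\<in>UNIV. ?g (\<nu> k))"
      by (simp add: X w)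
    also have "\<dots> = (\<Sum>k\<in>UNIV. ?g k)"
      by (rule sum.reindex_bij_betw[OF bij])
    finally show ?thesis
      by (simp add: ifft_def)
  qed
  then have "complex_of_real (Re (ifft idx X $ i $ j)) = ifft idx X $ i $ j" for i j
    by (metis Reals_cnj_iff of_real_Re)
  then show ?thesis
    by (simp add: complex_array_def spectral_conv_def X_def vec_eq_iff)
qed

end

theory Submission
  imports Defs
begin

text \<open>Affine maps are piecewise-linear, and piecewise-linear maps are closed under composition
  (\<open>piecewise_linear_compose\<close>), so it suffices to treat the building blocks of the
  network. With fixed weights a hidden layer is an affine map followed by a coordinatewise
  activation. The affine part rests on \<open>linear_spectral_conv\<close>: the spectral convolution
  looks nonlocal but is linear in the hidden state. The activation is the identity or ReLU, and ReLU
  is linear on each closed orthant (\<open>piecewise_linear_relu_array\<close>). Induction over the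
  layers, between the affine lifting and projection, concludes.\<close>

lemma linear_imp_affine_map: "linear f \<Longrightarrow> affine_map f"
  unfolding affine_map_def by (intro exI[of _ f] exI[of _ 0]) simp

lemma affine_map_add_const: "linear f \<Longrightarrow> affine_map (\<lambda>x. f x + c)"
  unfolding affine_map_def by blast

lemma affine_map_compose:
  assumes "affine_map g" "affine_map f"
  shows "affine_map (\<lambda>x. g (f x))"
proof -
  obtain A c where A: "linear A" "\<And>x. f x = A x + c"
    using assms(2) unfolding affine_map_def by blast
  obtain B d where B: "linear B" "\<And>x. g x = B x + d"
    using assms(1) unfolding affine_map_def by blast
  have "g (f x) = (B \<circ> A) x + (B c + d)" for x
    by (simp add: A B linear_add)
  moreover have "linear (B \<circ> A)"
    using A(1) B(1) by (rule linear_compose)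
  ultimately show ?thesis
    unfolding affine_map_def by blast
qed

text \<open>Preimages commute with intersections, and moving \<open>A\<close> across the inner
  product by its adjoint turns a half-space condition on \<open>A x + c\<close> into one on
  \<open>x\<close>.\<close>

lemma polyhedron_affine_vimage:
  fixes f :: "'a::euclidean_space \<Rightarrow> 'b::euclidean_space"
  assumes "polyhedron S" "affine_map f"
  shows "polyhedron (f -` S)"
proof -
  obtain A c where A: "linear A" "\<And>x. f x = A x + c"
    using assms(2) unfolding affine_map_def by blast
  obtain F where F: "finite F" "S = \<Inter>F" "\<forall>h\<in>F. \<exists>a b. a \<noteq> 0 \<and> h = {x. a \<bullet> x \<le> b}"
    using assms(1) unfolding polyhedron_def by blast
  have "polyhedron (f -` h)" if h: "h \<in> F" for h
  proof -
    obtain a b where "h = {x. a \<bullet> x \<le> b}"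
      using bspec[OF F(3) h] by (elim exE conjE)
    then have "f -` h = {x. adjoint A a \<bullet> x \<le> b - a \<bullet> c}"
      by (auto simp: A adjoint_clauses inner_add_right)
    then show ?thesis
      \<comment> \<open>\<open>adjoint A a\<close> may be zero; the set is then empty or the whole
        space, still a polyhedron.\<close>
      by (simp add: polyhedron_halfspace_le)
  qed
  moreover have "f -` S = \<Inter>((-`) f ` F)"
    using F(2) by blast
  ultimately show ?thesis
    using F(1) by (metis (no_types, lifting) finite_imageI imageE polyhedron_Inter)
qed

lemma affine_map_imp_piecewise_linear: "affine_map f \<Longrightarrow> piecewise_linear f"
  unfolding piecewise_linear_def by (intro exI[of _ "{UNIV}"]) auto

text \<open>Refine the pieces of the inner map by pulling back those of the outer map: on a refined
  piece both maps are affine, hence so is the composite.\<close>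

lemma piecewise_linear_compose:
  assumes "piecewise_linear g" "piecewise_linear f"
  shows "piecewise_linear (\<lambda>x. g (f x))"
proof -
  obtain \<P> where \<P>: "finite \<P>" "\<forall>S\<in>\<P>. polyhedron S" "\<Union>\<P> = UNIV"
      "\<forall>S\<in>\<P>. \<exists>f'. affine_map f' \<and> (\<forall>x\<in>S. f x = f' x)"
    using assms(2) unfolding piecewise_linear_def by (elim exE conjE) (rule that)
  obtain \<Q> where \<Q>: "finite \<Q>" "\<forall>T\<in>\<Q>. polyhedron T" "\<Union>\<Q> = UNIV"
      "\<forall>T\<in>\<Q>. \<exists>g'. affine_map g' \<and> (\<forall>y\<in>T. g y = g' y)"
    using assms(1) unfolding piecewise_linear_def by (elim exE conjE) (rule that)
  obtain F where F: "\<And>S. S \<in> \<P> \<Longrightarrow> affine_map (F S)" "\<And>S x. S \<in> \<P> \<Longrightarrow> x \<in> S \<Longrightarrow> f x = F S x"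
    using bchoice[OF \<P>(4)] by metis
  obtain G where G: "\<And>T. T \<in> \<Q> \<Longrightarrow> affine_map (G T)" "\<And>T y. T \<in> \<Q> \<Longrightarrow> y \<in> T \<Longrightarrow> g y = G T y"
    using bchoice[OF \<Q>(4)] by metis
  \<comment> \<open>The pullback is along the affine representative \<open>F S\<close>, not along
    \<open>f\<close>, so that it is a polyhedron; inside \<open>S\<close> the two agree.\<close>
  define \<R> where "\<R> = (\<lambda>(S, T). S \<inter> F S -` T) ` (\<P> \<times> \<Q>)"
  have "finite \<R>"
    using \<P>(1) \<Q>(1) by (simp add: \<R>_def)
  moreover have "polyhedron C" if "C \<in> \<R>" for C
    using that \<P>(2) \<Q>(2) F(1) by (auto simp: \<R>_def intro!: polyhedron_Int polyhedron_affine_vimage)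
  moreover have "x \<in> \<Union>\<R>" for x
  proof -
    obtain S T where "S \<in> \<P>" "x \<in> S" "T \<in> \<Q>" "F S x \<in> T"
      using \<P>(3) \<Q>(3) by (metis UNIV_I UnionE)
    then show ?thesis
      by (auto simp: \<R>_def)
  qed
  moreover have "\<exists>k. affine_map k \<and> (\<forall>x\<in>C. g (f x) = k x)" if C: "C \<in> \<R>" for C
  proof -
    obtain S T where "S \<in> \<P>" "T \<in> \<Q>" "C = S \<inter> F S -` T"
      using C by (auto simp: \<R>_def)
    then have "affine_map (\<lambda>x. G T (F S x)) \<and> (\<forall>x\<in>C. g (f x) = G T (F S x))"
      using F G by (auto intro: affine_map_compose)
    then show ?thesis by blast
  qed
  ultimately show ?thesis
    unfolding piecewise_linear_def by (intro exI[of _ \<R>] conjI ballI) auto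
qed

text \<open>One polyhedron for each set \<open>I\<close> of coordinates required to be nonnegative.\<close>

lemma piecewise_linear_relu_array:
  "piecewise_linear (\<lambda>z :: real^'h::finite^'n::finite. \<chi> i j. relu (z $ i $ j))"
proof -
  \<comment> \<open>The signs make \<open>C I\<close> the closed orthant with coordinates \<ge> 0 on
    \<open>I\<close> and \<le> 0 off \<open>I\<close>; the nested \<open>axis\<close> is a signed
    basis vector of the array space.\<close>
  define s :: "('n \<times> 'h) set \<Rightarrow> 'n \<times> 'h \<Rightarrow> real" where "s I p = (if p \<in> I then -1 else 1)" for I p
  define C :: "('n \<times> 'h) set \<Rightarrow> (real^'h^'n) set" where
    "C I = (\<Inter>p\<in>UNIV. {z. axis (fst p) (axis (snd p) (s I p)) \<bullet> z \<le> 0})" for I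
  have C: "z \<in> C I \<longleftrightarrow> (\<forall>i j. s I (i, j) * z $ i $ j \<le> 0)" for z I
    by (simp add: C_def inner_axis')
  have "polyhedron (C I)" for I
    unfolding C_def by (intro polyhedron_Inter) (auto simp: polyhedron_halfspace_le)
  moreover have "z \<in> C {(i, j). 0 \<le> z $ i $ j}" for z
    by (simp add: C s_def)
  then have "\<Union>(range C) = UNIV"
    by blast
  moreover have "\<exists>f. affine_map f \<and> (\<forall>z\<in>C I. (\<chi> i j. relu (z $ i $ j)) = f z)" for I
  proof (intro exI conjI ballI)
    \<comment> \<open>On \<open>C I\<close>, ReLU is the coordinate projection onto
      \<open>I\<close>.\<close>
    show "affine_map (\<lambda>z :: real^'h^'n. \<chi> i j. if (i, j) \<in> I then z $ i $ j else 0)"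
      by (intro linear_imp_affine_map linearI) (auto simp: vec_eq_iff)
    show "(\<chi> i j. relu (z $ i $ j)) = (\<chi> i j. if (i, j) \<in> I then z $ i $ j else 0)"
      if "z \<in> C I" for z
      using that unfolding C by (auto simp: vec_eq_iff relu_def s_def max_def split: if_splits)
         (metis order_antisym)+
  qed
  ultimately show ?thesis
    unfolding piecewise_linear_def by (intro exI[of _ "range C"]) auto
qed

text \<open>Embedding into complex arrays, FFT, entrywise multiplication by a fixed
  \<open>R\<close>, inverse FFT and real part are each linear over the reals.\<close>

lemma linear_spectral_conv: "linear (spectral_conv idx R)"
proof (rule linearI)
  show "spectral_conv idx R (x + y) = spectral_conv idx R x + spectral_conv idx R y" for x y
    by (simp add: spectral_conv_def ifft_def fft_def complex_array_def vec_eq_iff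
        algebra_simps sum.distrib add_divide_distrib)
  \<comment> \<open>Homogeneity is settled before taking real parts: the scalar comes out as a
    complex factor that is real, and \<open>Re\<close> commutes with such a factor.\<close>
  have "ifft idx (R * fft idx (complex_array (c *\<^sub>R x))) =
    (\<chi> i j. complex_of_real c * ifft idx (R * fft idx (complex_array x)) $ i $ j)" for c x
    by (simp add: ifft_def fft_def complex_array_def vec_eq_iff
        sum_distrib_left sum_distrib_right sum_divide_distrib mult_ac)
  then show "spectral_conv idx R (c *\<^sub>R x) = c *\<^sub>R spectral_conv idx R x" for c x
    by (simp add: spectral_conv_def vec_eq_iff)
qed

lemma affine_map_pre_activation:
  "affine_map (\<lambda>h. \<chi> i j. spectral_conv idx R h $ i $ j + (\<Sum>m\<in>UNIV. W $ j $ m * h $ i $ m) + b $ j)"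
proof -
  define A where "A h = (\<chi> i j. spectral_conv idx R h $ i $ j + (\<Sum>m\<in>UNIV. W $ j $ m * h $ i $ m))" for h
  have "linear A"
    by (rule linearI)
       (simp_all add: A_def vec_eq_iff linear_add[OF linear_spectral_conv]
          linear_scale[OF linear_spectral_conv] algebra_simps sum.distrib sum_distrib_left)
  \<comment> \<open>The bias is the same at every grid point, so the translation is the array whose
    rows all equal \<open>b\<close>.\<close>
  from affine_map_add_const[OF this, of "\<chi> i. b"] show ?thesis
    by (simp add: A_def plus_vec_def)
qed

lemma piecewise_linear_hidden_layer:
  fixes W :: "real^'h::finite^'h"
  assumes "\<sigma> = relu \<or> \<sigma> = (\<lambda>t. t)"
  shows "piecewise_linear (hidden_layer idx R W b \<sigma>)"
proof -
  have "piecewise_linear (\<lambda>z :: real^'h^'n. \<chi> i j. \<sigma> (z $ i $ j))"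
    using assms piecewise_linear_relu_array
      affine_map_imp_piecewise_linear[OF linear_imp_affine_map[OF linear_id]]
    by (auto simp: id_def)
  from piecewise_linear_compose
    [OF this affine_map_imp_piecewise_linear[OF affine_map_pre_activation[of idx R W b]]]
  show ?thesis
    by (simp add: hidden_layer_def[abs_def])
qed

lemma piecewise_linear_hidden_state:
  assumes "affine_map P" "\<And>k. k \<in> {1..l} \<Longrightarrow> \<sigma> k = relu \<or> \<sigma> k = (\<lambda>t. t)"
  shows "piecewise_linear (hidden_state idx P R W b \<sigma> l)"
  \<comment> \<open>The range \<open>{1..l}\<close> grows with \<open>l\<close>, so the activation
    hypothesis must be carried through the induction.\<close>
  using assms(2)
proof (induction l)
  case 0
  have "hidden_state idx P R W b \<sigma> 0 = P" by auto
  then show ?case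
    using assms(1) by (simp add: affine_map_imp_piecewise_linear)
next
  case (Suc l)
  have "piecewise_linear (\<lambda>u. hidden_layer idx (R (Suc l)) (W (Suc l)) (b (Suc l)) (\<sigma> (Suc l))
      (hidden_state idx P R W b \<sigma> l u))"
    using Suc by (intro piecewise_linear_compose[OF piecewise_linear_hidden_layer]) auto
  then show ?case
    by simp
qed

theorem proposition1:
  fixes idx :: "'n::finite \<Rightarrow> nat"
    and P :: "real^'n \<Rightarrow> real^'h::finite^'n"
    and R :: "nat \<Rightarrow> complex^'h^'n"
    and W :: "nat \<Rightarrow> real^'h^'h"
    and b :: "nat \<Rightarrow> real^'h"
    and \<sigma> :: "nat \<Rightarrow> real \<Rightarrow> real"
    and Q :: "real^'h^'n \<Rightarrow> real^'n"
    and L :: nat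
  assumes "bij_betw idx UNIV {0..<CARD('n)}"
    and "L \<ge> 1"
    and "affine_map P"
    and "\<And>l. l \<in> {1..L} \<Longrightarrow> conj_symmetric idx (R l)"
    and "\<And>l. l \<in> {1..L} \<Longrightarrow> \<sigma> l = relu \<or> \<sigma> l = (\<lambda>t. t)"
    and "affine_map Q"
  shows "piecewise_linear (fno idx P R W b \<sigma> Q L)"
  unfolding fno_def[abs_def]
  using piecewise_linear_compose[OF affine_map_imp_piecewise_linear[OF assms(6)]
      piecewise_linear_hidden_state[OF assms(3,5)]] .

end
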